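(* Let $D\in\mathbb{Z}^+$ and let $\mathcal{A}=\{\mathbf{a}_1,\ldots,\mathbf{a}_n\}\subset\mathbb{N}^3$ be a finite set with $|\mathbf{a}_i|=D$ for all $i$ and $\mathbf{a}_{n-2}=D\boldsymbol\epsilon_1$, $\mathbf{a}_{n-1}=D\boldsymbol\epsilon_2$, $\mathbf{a}_n=D\boldsymbol\epsilon_3$. Let $\mathcal{S}$ be the monoid spanned by $\mathcal{A}$. With the notation of the context, for all $s\in\mathbb{N}$, $$|\mathrm{AP}_s|=\bigl(|s\mathcal{A}|-3|(s-1)\mathcal{A}|+3|(s-2)\mathcal{A}|-|(s-3)\mathcal{A}|\bigr)+|E_s^{3,1}|+|E_s^{2,0}|+2|E_s^{3,0}|-|E_s^{3,3}|.$$
   Context: $\{\boldsymbol\epsilon_1,\boldsymbol\epsilon_2,\boldsymbol\epsilon_3\}$ is the canonical basis of $\mathbb{N}^3$; for a vector, $|\cdot|$ is the sum of its entries; for a finite set, $|\cdot|$ is its cardinality. $\mathcal{S}=\{\sum_i\lambda_i\mathbf{a}_i\mid\lambda_i\in\mathbb{N}\}$ and $\mathbf{e}_i=D\boldsymbol\epsilon_i$ for $i=1,2,3$. For $s\in\mathbb{N}$, the $s$-fold sumset is $0\mathcal{A}=\{\mathbf{0}\}$ and $s\mathcal{A}=\{\mathbf{a}_{i_1}+\cdots+\mathbf{a}_{i_s}\mid1\le i_1\le\cdots\le i_s\le n\}$ for $s\ge1$; for $s<0$ we set $s\mathcal{A}=\emptyset$. For $s\in\mathbb{N}$ let $H_s=\{(x,y,z)\in\mathbb{N}^3\mid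 x+y+z=sD\}$, and for $F\subset\mathcal{S}$ let $F_s=F\cap H_s$. The sets $\mathrm{AP}_s,E_s^{3,1},E_s^{2,0},E_s^{3,0},E_s^{3,3}$ are the intersections with $H_s$ of the following sets $\mathrm{AP}_{\mathcal{S}},E_{\mathcal{S}}^{3,1},E_{\mathcal{S}}^{2,0},E_{\mathcal{S}}^{3,0},E_{\mathcal{S}}^{3,3}$. Apery set: $\mathrm{AP}_{\mathcal{S}}=\{\mathbf{s}\in\mathcal{S}\mid\mathbf{s}-\mathbf{e}_i\notin\mathcal{S}\text{ for all }i=1,2,3\}$. Exceptional sets: - $E_{\mathcal{S}}^{3,1}$: all $\mathbf{s}\in\mathcal{S}$ with $\mathbf{s}-\mathbf{e}_j\in\mathcal{S}$ for all $j$ and such that, for some permutation $(i_1,i_2,i_3)$ of $(1,2,3)$, $\mathbf{s}-(\mathbf{e}_{i_1}+\mathbf{e}_{i_2})\in\mathcal{S}$, $\mathbf{s}-(\mathbf{e}_{i_1}+\mathbf{e}_{i_3})\notin\mathcal{S}$, $\mathbf{s}-(\mathbf{e}_{i_2}+\mathbf{e}_{i_3})\notin\mathcal{S}$. - $E_{\mathcal{S}}^{2,0}$: all $\mathbf{s}\in\mathcal{S}$ such that, for some permutation $(i_1,i_2,i_3)$ of $(1,2,3)$, $\mathbf{s}-\mathbf{e}_{i_1}\in\mathcal{S}$, $\mathbf{s}-\mathbf{e}_{i_2}\in\mathcal{S}$, $\mathbf{s}-\mathbf{e}_{i_3}\notin\mathcal{S}$ and $\mathbf{s}-(\mathbf{e}_{i_1}+\mathbf{e}_{i_2})\notin\mathcal{S}$.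 - $E_{\mathcal{S}}^{3,0}$: all $\mathbf{s}\in\mathcal{S}$ with $\mathbf{s}-\mathbf{e}_i\in\mathcal{S}$ for all $i$ and $\mathbf{s}-(\mathbf{e}_i+\mathbf{e}_j)\notin\mathcal{S}$ for all $i\ne j$. - $E_{\mathcal{S}}^{3,3}$: all $\mathbf{s}\in\mathcal{S}$ with $\mathbf{s}-\mathbf{e}_i\in\mathcal{S}$ for all $i$, $\mathbf{s}-(\mathbf{e}_i+\mathbf{e}_j)\in\mathcal{S}$ for all $i\ne j$, and $\mathbf{s}-(\mathbf{e}_1+\mathbf{e}_2+\mathbf{e}_3)\notin\mathcal{S}$. *)

theory Defs
  imports "HOL-Analysis.Finite_Cartesian_Product" "HOL-Analysis.Cartesian_Space"
begin

text \<open>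
  Vectors live in \<open>int ^ 3\<close>, so that \<open>s - e i \<notin> S\<close> refers to genuine subtraction in the ambient
  group rather than to truncated subtraction of naturals; \<open>nat_vecs\<close> is the copy of
  the monoid of triples of naturals. In the index type \<open>3\<close> the third index \<open>3\<close> equals \<open>0\<close>;
  the indices \<open>1\<close>, \<open>2\<close>, \<open>3\<close> are distinct and exhaust the type.
\<close>

definition nat_vecs :: "(int ^ 3) set" where
  "nat_vecs = {v. \<forall>k. 0 \<le> v $ k}"

definition entry_sum :: "int ^ 3 \<Rightarrow> int" where
  "entry_sum v = (\<Sum>k\<in>UNIV. v $ k)"

definition extremal :: "nat \<Rightarrow> 3 \<Rightarrow> int ^ 3" where
  "extremal D k = axis k (int D)"

definition spanned_monoid :: "nat \<Rightarrow> (nat \<Rightarrow> int ^ 3) \<Rightarrow> (int ^ 3) set" where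
  "spanned_monoid n a = {\<Sum>i=1..n. int (l i) *s a i | l :: nat \<Rightarrow> nat. True}"

text \<open>A sorted list of indices encodes \<open>1 \<le> i\<^sub>1 \<le> \<dots> \<le> i\<^sub>s \<le> n\<close>; for \<open>s = 0\<close> only the empty
  list remains, which gives \<open>{0}\<close>.\<close>

definition sumset :: "nat \<Rightarrow> (nat \<Rightarrow> int ^ 3) \<Rightarrow> int \<Rightarrow> (int ^ 3) set" where
  "sumset n a s =
     (if s < 0 then {}
      else {sum_list (map a js) | js. length js = nat s \<and> sorted js \<and> set js \<subseteq> {1..n}})"

definition level :: "nat \<Rightarrow> nat \<Rightarrow> (int ^ 3) set" where
  "level D s = {v \<in> nat_vecs. entry_sum v = int (s * D)}"

definition apery_set :: "nat \<Rightarrow> (int ^ 3) set \<Rightarrow> (int ^ 3) set" where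
  "apery_set D S = {v \<in> S. \<forall>k. v - extremal D k \<notin> S}"

text \<open>In the next definitions a permutation \<open>(i\<^sub>1, i\<^sub>2, i\<^sub>3)\<close> of \<open>(1, 2, 3)\<close> is given by a bijection
  \<open>p\<close> of the index type, with \<open>i\<^sub>k = p k\<close>.\<close>

definition exceptional_3_1 :: "nat \<Rightarrow> (int ^ 3) set \<Rightarrow> (int ^ 3) set" where
  "exceptional_3_1 D S = {v \<in> S. (\<forall>k. v - extremal D k \<in> S) \<and>
     (\<exists>p :: 3 \<Rightarrow> 3. bij p \<and>
        v - (extremal D (p 1) + extremal D (p 2)) \<in> S \<and>
        v - (extremal D (p 1) + extremal D (p 3)) \<notin> S \<and>
        v - (extremal D (p 2) + extremal D (p 3)) \<notin> S)}"

definition exceptional_2_0 :: "nat \<Rightarrow> (int ^ 3) set \<Rightarrow> (int ^ 3) set" where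
  "exceptional_2_0 D S = {v \<in> S. \<exists>p :: 3 \<Rightarrow> 3. bij p \<and>
     v - extremal D (p 1) \<in> S \<and>
     v - extremal D (p 2) \<in> S \<and>
     v - extremal D (p 3) \<notin> S \<and>
     v - (extremal D (p 1) + extremal D (p 2)) \<notin> S}"

definition exceptional_3_0 :: "nat \<Rightarrow> (int ^ 3) set \<Rightarrow> (int ^ 3) set" where
  "exceptional_3_0 D S = {v \<in> S. (\<forall>k. v - extremal D k \<in> S) \<and>
     (\<forall>j k. j \<noteq> k \<longrightarrow> v - (extremal D j + extremal D k) \<notin> S)}"

definition exceptional_3_3 :: "nat \<Rightarrow> (int ^ 3) set \<Rightarrow> (int ^ 3) set" where
  "exceptional_3_3 D S = {v \<in> S. (\<forall>k. v - extremal D k \<in> S) \<and>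
     (\<forall>j k. j \<noteq> k \<longrightarrow> v - (extremal D j + extremal D k) \<in> S) \<and>
     v - (extremal D 1 + extremal D 2 + extremal D 3) \<notin> S}"

end

theory Submission
  imports Defs "HOL-Library.Multiset"
begin

text \<open>
  Translation by \<open>w\<close> identifies the sumset at level \<open>s - m\<close> with the elements \<open>v\<close> of level \<open>s\<close>
  such that \<open>v - w \<in> S\<close>, where \<open>w\<close> is a sum of \<open>m\<close> extremal vectors. The alternating sum of sumset
  cardinalities thus becomes a sum over \<open>v\<close> of the quantity \<open>\<Sum>\<^sub>T (-1)\<^bsup>|T|\<^esup> [v - e\<^sub>T \<in> S]\<close>, where \<open>T\<close>
  ranges over the subsets of \<open>{1, 2, 3}\<close>. Since the family of all \<open>T\<close> with \<open>v - e\<^sub>T \<in> S\<close> is closed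
  under taking subsets, only few families are possible; each contributes \<open>0\<close>, except those that
  define the Apery set and the four exceptional sets.
\<close>

section \<open>Entry sums and closure properties of the spanned monoid\<close>

lemma entry_sum_add [simp]: "entry_sum (v + w) = entry_sum v + entry_sum w"
  by (simp add: entry_sum_def sum.distrib)

lemma entry_sum_diff [simp]: "entry_sum (v - w) = entry_sum v - entry_sum w"
  by (simp add: entry_sum_def sum_subtractf)

lemma entry_sum_scale [simp]: "entry_sum (c *s v) = c * entry_sum v"
  by (simp add: entry_sum_def sum_distrib_left)

lemma entry_sum_sum: "entry_sum (sum f A) = (\<Sum>i\<in>A. entry_sum (f i))"
  by (induction A rule: infinite_finite_induct) (simp_all, simp_all add: entry_sum_def)

lemma entry_sum_extremal [simp]: "entry_sum (extremal D k) = int D"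
  by (simp add: entry_sum_def extremal_def axis_def)

lemma entry_sum_nonneg: "v \<in> nat_vecs \<Longrightarrow> 0 \<le> entry_sum v"
  by (simp add: entry_sum_def nat_vecs_def sum_nonneg)

lemma spanned_monoid_add:
  assumes "v \<in> spanned_monoid n a" "w \<in> spanned_monoid n a"
  shows "v + w \<in> spanned_monoid n a"
proof -
  obtain l l' :: "nat \<Rightarrow> nat" where "v = (\<Sum>i=1..n. int (l i) *s a i)" "w = (\<Sum>i=1..n. int (l' i) *s a i)"
    using assms by (auto simp: spanned_monoid_def)
  then have "v + w = (\<Sum>i=1..n. int (l i + l' i) *s a i)"
    by (simp add: sum.distrib vector_sadd_rdistrib)
  then show ?thesis
    unfolding spanned_monoid_def by (intro CollectI exI[of _ "\<lambda>i. l i + l' i"]) simp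
qed

lemma generator_in_spanned_monoid:
  assumes "i \<in> {1..n}"
  shows "a i \<in> spanned_monoid n a"
proof -
  have "(\<Sum>j=1..n. int (of_bool (j = i)) *s a j) = (\<Sum>j=1..n. if j = i then a j else 0)"
    by (intro sum.cong) auto
  also have "\<dots> = a i"
    using assms by simp
  finally show ?thesis
    unfolding spanned_monoid_def by (intro CollectI exI[of _ "\<lambda>j. of_bool (j = i)"]) simp
qed

lemma spanned_monoid_subset_nat_vecs:
  assumes "\<And>i. i \<in> {1..n} \<Longrightarrow> a i \<in> nat_vecs"
  shows "spanned_monoid n a \<subseteq> nat_vecs"
  using assms by (auto simp: spanned_monoid_def nat_vecs_def intro!: sum_nonneg)

section \<open>Sumsets as levels of the spanned monoid\<close>

lemma sum_list_map_eq_sum_count_smult: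
  fixes a :: "nat \<Rightarrow> int ^ 3"
  assumes "set js \<subseteq> A" "finite A"
  shows "sum_list (map a js) = (\<Sum>i\<in>A. int (count_list js i) *s a i)"
  using assms(1)
proof (induction js)
  case (Cons j js)
  have "(\<Sum>i\<in>A. int (count_list (j # js) i) *s a i)
      = (\<Sum>i\<in>A. (if i = j then a i else 0) + int (count_list js i) *s a i)"
    by (intro sum.cong) (auto simp: vector_sadd_rdistrib)
  also have "\<dots> = a j + (\<Sum>i\<in>A. int (count_list js i) *s a i)"
    using Cons.prems assms(2) by (simp add: sum.distrib)
  finally show ?case
    using Cons by simp
qed simp

text \<open>Every generator has entry sum \<open>D > 0\<close>, so the entry sum of an element
  determines its number of summands. For negative \<open>z\<close> both sides are empty, because
  elements of the monoid have nonnegative entries.\<close>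

lemma sumset_eq:
  assumes "D > 0" and gen: "\<And>i. i \<in> {1..n} \<Longrightarrow> a i \<in> nat_vecs \<and> entry_sum (a i) = int D"
  shows "sumset n a z = {v \<in> spanned_monoid n a. entry_sum v = z * int D}"
proof (cases "z < 0")
  case True
  have "entry_sum v \<noteq> z * int D" if "v \<in> spanned_monoid n a" for v
  proof -
    have "z * int D < 0"
      using True \<open>D > 0\<close> by (simp add: mult_neg_pos)
    moreover have "0 \<le> entry_sum v"
      using that spanned_monoid_subset_nat_vecs[of n a] gen by (auto intro!: entry_sum_nonneg)
    ultimately show ?thesis by linarith
  qed
  then show ?thesis
    using True by (auto simp: sumset_def)
next
  case False
  have entry_sum_comb: "entry_sum (\<Sum>i=1..n. int (l i) *s a i) = int (\<Sum>i=1..n. l i) * int D" for l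
    using gen by (simp add: entry_sum_sum sum_distrib_right)
  show ?thesis
  proof (intro set_eqI iffI)
    fix v assume "v \<in> sumset n a z"
    then obtain js where js: "v = sum_list (map a js)" "length js = nat z" "set js \<subseteq> {1..n}"
      using False by (auto simp: sumset_def)
    then have v: "v = (\<Sum>i=1..n. int (count_list js i) *s a i)"
      by (simp add: sum_list_map_eq_sum_count_smult)
    moreover have "(\<Sum>i=1..n. count_list js i) = nat z"
      using js sum_count_set[of js "{1..n}"] by simp
    ultimately have "entry_sum v = z * int D"
      using False entry_sum_comb[of "count_list js"] by (simp flip: of_nat_sum)
    with v show "v \<in> {v \<in> spanned_monoid n a. entry_sum v = z * int D}"
      by (auto simp: spanned_monoid_def)
  next
    fix v assume "v \<in> {v \<in> spanned_monoid n a. entry_sum v = z * int D}"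
    then obtain l :: "nat \<Rightarrow> nat" where v: "v = (\<Sum>i=1..n. int (l i) *s a i)"
      and "entry_sum v = z * int D"
      by (auto simp: spanned_monoid_def)
    then have z: "z = int (\<Sum>i=1..n. l i)"
      using \<open>D > 0\<close> entry_sum_comb[of l] by simp
    \<comment> \<open>Index \<open>i\<close> is taken \<open>l i\<close> times; sorting this
      multiset gives the weakly increasing index list that \<open>sumset\<close> asks for.\<close>
    define M where "M = (\<Sum>i=1..n. replicate_mset (l i) i)"
    define js where "js = sorted_list_of_multiset M"
    have mset_js: "mset js = M"
      by (simp add: js_def)
    have count_M: "count M i = (if i \<in> {1..n} then l i else 0)" for i
      by (simp add: M_def count_sum)
    have "set js \<subseteq> {1..n}"
      using count_M by (auto simp: js_def simp flip: count_greater_zero_iff split: if_splits)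
    moreover from this have "sum_list (map a js) = v"
      using count_M
      by (simp add: sum_list_map_eq_sum_count_smult v mset_js flip: count_mset)
    moreover have "length js = nat z"
    proof -
      have "size M = (\<Sum>i=1..n. size (replicate_mset (l i) i))"
        unfolding M_def by (rule size_multiset_sum)
      then show ?thesis
        by (simp add: z mset_js flip: size_mset of_nat_sum)
    qed
    moreover have "sorted js"
      by (simp add: js_def)
    ultimately show "v \<in> sumset n a z"
      using False by (auto simp: sumset_def)
  qed
qed

text \<open>Ensures that each level of the monoid is finite, so that cardinalities can be written as
  sums of indicators.\<close>

lemma finite_sumset: "finite (sumset n a z)"
proof -
  have "sumset n a z \<subseteq> (\<lambda>js. sum_list (map a js)) ` {js. set js \<subseteq> {1..n} \<and> length js = nat z}"
    by (auto simp: sumset_def)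
  then show ?thesis
    by (rule finite_subset) (intro finite_imageI finite_lists_length_eq finite_atLeastAtMost)
qed

section \<open>Permutations of three indices, counting and inclusion-exclusion\<close>

lemma ex_bij_3_iff:
  "(\<exists>p :: 3 \<Rightarrow> 3. bij p \<and> Q (p 1) (p 2) (p 3)) \<longleftrightarrow>
     Q 1 2 3 \<or> Q 1 3 2 \<or> Q 2 1 3 \<or> Q 2 3 1 \<or> Q 3 1 2 \<or> Q 3 2 1"
    (is "?L \<longleftrightarrow> ?R")
proof
  assume ?L
  then obtain p :: "3 \<Rightarrow> 3" where p: "inj p" "Q (p 1) (p 2) (p 3)"
    by (auto simp: bij_def)
  then have "p 1 \<noteq> p 2" "p 1 \<noteq> p 3" "p 2 \<noteq> p 3"
    by (simp_all add: inj_eq)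
  with p(2) show ?R
    using exhaust_3[of "p 1"] exhaust_3[of "p 2"] exhaust_3[of "p 3"] by auto
next
  \<comment> \<open>Any distinct \<open>i\<close>, \<open>j\<close>, \<open>k\<close> come from the
    permutation sending 1, 2, 3 to them; on a finite type injectivity is enough.\<close>
  have ex: ?L if "Q i j k" "i \<noteq> j" "i \<noteq> k" "j \<noteq> k" for i j k
  proof (intro exI conjI)
    let ?p = "\<lambda>x :: 3. if x = 1 then i else if x = 2 then j else k"
    show "bij ?p"
    proof -
      have "inj ?p"
        using that exhaust_3 by (auto simp: inj_def)
      then show ?thesis
        using finite_UNIV_inj_surj[OF finite] unfolding bij_def by blast
    qed
    show "Q (?p 1) (?p 2) (?p 3)"
      using that by simp
  qed
  assume ?R
  then show ?L
    using ex by force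
qed

lemma card_eq_sum_indicator:
  assumes "finite U"
  shows "int (card {v \<in> U. P v}) = (\<Sum>v\<in>U. of_bool (P v))"
  using assms by (simp add: of_bool_def sum.If_cases Int_def)

text \<open>The map \<open>v \<mapsto> v + w\<close> is inverted by subtracting \<open>w\<close>. It
  lands in \<open>S\<close> because \<open>S\<close> is closed under addition.\<close>

lemma card_translate:
  fixes S :: "(int ^ 3) set"
  assumes add: "\<And>v w. v \<in> S \<Longrightarrow> w \<in> S \<Longrightarrow> v + w \<in> S" and "w \<in> S"
  shows "card {v \<in> S. entry_sum v = c - entry_sum w} =
         card {v \<in> {v \<in> S. entry_sum v = c}. v - w \<in> S}"
proof (rule bij_betw_same_card[of "\<lambda>v. v + w"])
  have "v \<in> S" if "v - w \<in> S" for v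
    using add[OF that \<open>w \<in> S\<close>] by simp
  then show "bij_betw (\<lambda>v. v + w) {v \<in> S. entry_sum v = c - entry_sum w}
        {v \<in> {v \<in> S. entry_sum v = c}. v - w \<in> S}"
    using assms by (intro bij_betw_byWitness[where f' = "\<lambda>v. v - w"]) auto
qed

lemma forall_distinct_3:
  "(\<forall>i j :: 3. i \<noteq> j \<longrightarrow> P i j) \<longleftrightarrow> P 1 2 \<and> P 1 3 \<and> P 2 1 \<and> P 2 3 \<and> P 3 1 \<and> P 3 2"
  by (auto simp: forall_3)

text \<open>Read \<open>P12\<close> as \<open>v - (e1 + e2) \<in> S\<close>, and so on; the
  assumptions say that the family is closed under subsets. The alternating sum is 1 if no singleton
  occurs, -1 for two singletons without their pair, and -2, -1, 0 for three singletons with zero,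
  one, two pairs. With all three pairs it is 1 without the triple and 0 with it. In the remaining
  cases it is 0, so the last four terms correct it to the indicator on the left.\<close>

lemma inclusion_exclusion_3:
  assumes "P12 \<Longrightarrow> P1 \<and> P2" "P13 \<Longrightarrow> P1 \<and> P3" "P23 \<Longrightarrow> P2 \<and> P3" "P123 \<Longrightarrow> P12 \<and> P13 \<and> P23"
  shows "of_bool (\<not> P1 \<and> \<not> P2 \<and> \<not> P3) =
    1 - of_bool P1 - of_bool P2 - of_bool P3 + of_bool P12 + of_bool P13 + of_bool P23
       - (of_bool P123 :: int)
    + of_bool ((P1 \<and> P2 \<and> P3) \<and>
        (P12 \<and> \<not> P13 \<and> \<not> P23 \<or> P13 \<and> \<not> P12 \<and> \<not> P23 \<or> P23 \<and> \<not> P12 \<and> \<not> P13))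
    + of_bool (P1 \<and> P2 \<and> \<not> P3 \<and> \<not> P12 \<or> P1 \<and> P3 \<and> \<not> P2 \<and> \<not> P13 \<or> P2 \<and> P3 \<and> \<not> P1 \<and> \<not> P23)
    + 2 * of_bool ((P1 \<and> P2 \<and> P3) \<and> \<not> P12 \<and> \<not> P13 \<and> \<not> P23)
    - of_bool ((P1 \<and> P2 \<and> P3) \<and> (P12 \<and> P13 \<and> P23) \<and> \<not> P123)"
  using assms
  by (cases P1) (cases P2; cases P3; cases P12; cases P13; cases P23; cases P123; simp)+

theorem proposition2p8:
  fixes D n s :: nat and a :: "nat \<Rightarrow> int ^ 3" and S :: "(int ^ 3) set"
  assumes "D > 0" and "n \<ge> 3"
    and "inj_on a {1..n}"
    and "\<forall>i\<in>{1..n}. a i \<in> nat_vecs \<and> entry_sum (a i) = int D"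
    and "a (n - 2) = extremal D 1" and "a (n - 1) = extremal D 2" and "a n = extremal D 3"
    and "S = spanned_monoid n a"
  shows "int (card (apery_set D S \<inter> level D s)) =
      (int (card (sumset n a (int s))) - 3 * int (card (sumset n a (int s - 1)))
         + 3 * int (card (sumset n a (int s - 2))) - int (card (sumset n a (int s - 3))))
      + int (card (exceptional_3_1 D S \<inter> level D s))
      + int (card (exceptional_2_0 D S \<inter> level D s))
      + 2 * int (card (exceptional_3_0 D S \<inter> level D s))
      - int (card (exceptional_3_3 D S \<inter> level D s))"
proof -
  let ?e = "extremal D"
  define U where "U = {v \<in> S. entry_sum v = int s * int D}"
  define N where "N v w = (of_bool (v - w \<in> S) :: int)" for v w
  have gen: "a i \<in> nat_vecs \<and> entry_sum (a i) = int D" if "i \<in> {1..n}" for i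
    using assms(4) that by blast
  have add: "v + w \<in> S" if "v \<in> S" "w \<in> S" for v w
    using that spanned_monoid_add assms(8) by blast
  have "a (n - 2) \<in> S" "a (n - 1) \<in> S" "a n \<in> S"
    unfolding assms(8) by (rule generator_in_spanned_monoid, use \<open>n \<ge> 3\<close> in simp)+
  then have e_mem: "?e k \<in> S" for k
    using assms(5-7) exhaust_3[of k] by auto
  have "finite U"
    using finite_sumset[of n a "int s"] sumset_eq[OF \<open>D > 0\<close> gen, where z = "int s"] assms(8)
    by (simp add: U_def)
  have "S \<subseteq> nat_vecs"
    unfolding assms(8) by (rule spanned_monoid_subset_nat_vecs) (use gen in blast)
  \<comment> \<open>Membership in \<open>nat_vecs\<close>, demanded by \<open>level\<close>, is
    automatic in \<open>S\<close>, so only the entry sum matters.\<close>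
  then have card_level: "int (card ({v \<in> S. P v} \<inter> level D s)) = (\<Sum>v\<in>U. of_bool (P v))" for P
  proof -
    have "{v \<in> S. P v} \<inter> level D s = {v \<in> U. P v}"
      using \<open>S \<subseteq> nat_vecs\<close> by (auto simp: U_def level_def)
    then show ?thesis
      by (simp only: card_eq_sum_indicator[OF \<open>finite U\<close>])
  qed
  \<comment> \<open>Here \<open>m\<close> counts the extremal vectors in \<open>w\<close>. If
    \<open>m\<close> exceeds \<open>s\<close>, the sumset is empty and every indicator is 0.\<close>
  have card_sumset: "int (card (sumset n a (int s - m))) = (\<Sum>v\<in>U. N v w)"
    if "w \<in> S" "entry_sum w = m * int D" for w m
  proof -
    have "sumset n a (int s - m) = {v \<in> S. entry_sum v = int s * int D - entry_sum w}"
      using sumset_eq[OF \<open>D > 0\<close> gen] that by (simp add: assms(8) left_diff_distrib)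
    then show ?thesis
      using card_translate[OF add \<open>w \<in> S\<close>, of "int s * int D"]
      by (simp add: N_def U_def [symmetric] card_eq_sum_indicator[OF \<open>finite U\<close>])
  qed
  have card0: "int (card (sumset n a (int s))) = (\<Sum>v\<in>U. 1)"
    using sumset_eq[OF \<open>D > 0\<close> gen] by (simp add: U_def assms(8))
  \<comment> \<open>The index is left free: the three copies of one cardinality in the formula are
    matched with three different shifts. The same is done for pairs.\<close>
  have card1: "int (card (sumset n a (int s - 1))) = (\<Sum>v\<in>U. N v (?e i))" for i
    by (rule card_sumset) (simp_all add: e_mem)
  have card2: "int (card (sumset n a (int s - 2))) = (\<Sum>v\<in>U. N v (?e i + ?e j))" for i j
    by (rule card_sumset) (simp_all add: e_mem add)
  have card3: "int (card (sumset n a (int s - 3))) = (\<Sum>v\<in>U. N v (?e 1 + ?e 2 + ?e 3))"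
    by (rule card_sumset) (simp_all add: e_mem add)
  have alternating_sum:
    "int (card (sumset n a (int s))) - 3 * int (card (sumset n a (int s - 1)))
         + 3 * int (card (sumset n a (int s - 2))) - int (card (sumset n a (int s - 3)))
      = (\<Sum>v\<in>U. 1 - N v (?e 1) - N v (?e 2) - N v (?e 3)
           + N v (?e 1 + ?e 2) + N v (?e 1 + ?e 3) + N v (?e 2 + ?e 3) - N v (?e 1 + ?e 2 + ?e 3))"
    using card0 card1[of 1] card1[of 2] card1[of 3] card2[of 1 2] card2[of 1 3] card2[of 2 3] card3
    by (simp only: sum.distrib sum_subtractf)
  \<comment> \<open>Adding an extremal vector back stays in \<open>S\<close>. This yields the
    closure under subsets required by \<open>inclusion_exclusion_3\<close>; the triple sum needs
    reordering for two of its pairs.\<close>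
  have down: "v - w \<in> S" if "v - (w + ?e k) \<in> S" for v w k
    using add[OF that e_mem[of k]] by simp
  have down': "v - w \<in> S" if "v - (?e k + w) \<in> S" for v w k
    using down that by (simp add: add.commute)
  have down3: "v - (?e 1 + ?e 3) \<in> S" if "v - (?e 1 + ?e 2 + ?e 3) \<in> S" for v
    using down[of v "?e 1 + ?e 3" 2] that by (simp add: ac_simps)
  have down3': "v - (?e 2 + ?e 3) \<in> S" if "v - (?e 1 + ?e 2 + ?e 3) \<in> S" for v
    using down'[of v 1 "?e 2 + ?e 3"] that by (simp add: ac_simps)
  \<comment> \<open>Both exceptional conditions are symmetric in the first two indices, so with pair
    sums in a fixed order the six permutations collapse to three cases.\<close>
  have comm: "?e 2 + ?e 1 = ?e 1 + ?e 2" "?e 3 + ?e 1 = ?e 1 + ?e 3" "?e 3 + ?e 2 = ?e 2 + ?e 3"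
    by (simp_all add: add.commute)
  have ex_3_1: "(\<exists>p :: 3 \<Rightarrow> 3. bij p \<and> v - (?e (p 1) + ?e (p 2)) \<in> S \<and>
        v - (?e (p 1) + ?e (p 3)) \<notin> S \<and> v - (?e (p 2) + ?e (p 3)) \<notin> S) \<longleftrightarrow>
      v - (?e 1 + ?e 2) \<in> S \<and> v - (?e 1 + ?e 3) \<notin> S \<and> v - (?e 2 + ?e 3) \<notin> S \<or>
      v - (?e 1 + ?e 3) \<in> S \<and> v - (?e 1 + ?e 2) \<notin> S \<and> v - (?e 2 + ?e 3) \<notin> S \<or>
      v - (?e 2 + ?e 3) \<in> S \<and> v - (?e 1 + ?e 2) \<notin> S \<and> v - (?e 1 + ?e 3) \<notin> S" for v
    unfolding ex_bij_3_iff[where Q = "\<lambda>i j k. v - (?e i + ?e j) \<in> S \<and> v - (?e i + ?e k) \<notin> S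
          \<and> v - (?e j + ?e k) \<notin> S"] comm by blast
  have ex_2_0: "(\<exists>p :: 3 \<Rightarrow> 3. bij p \<and> v - ?e (p 1) \<in> S \<and> v - ?e (p 2) \<in> S \<and> v - ?e (p 3) \<notin> S \<and>
        v - (?e (p 1) + ?e (p 2)) \<notin> S) \<longleftrightarrow>
      v - ?e 1 \<in> S \<and> v - ?e 2 \<in> S \<and> v - ?e 3 \<notin> S \<and> v - (?e 1 + ?e 2) \<notin> S \<or>
      v - ?e 1 \<in> S \<and> v - ?e 3 \<in> S \<and> v - ?e 2 \<notin> S \<and> v - (?e 1 + ?e 3) \<notin> S \<or>
      v - ?e 2 \<in> S \<and> v - ?e 3 \<in> S \<and> v - ?e 1 \<notin> S \<and> v - (?e 2 + ?e 3) \<notin> S" for v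
    unfolding ex_bij_3_iff[where Q = "\<lambda>i j k. v - ?e i \<in> S \<and> v - ?e j \<in> S \<and> v - ?e k \<notin> S
          \<and> v - (?e i + ?e j) \<notin> S"] comm by blast
  have all_pairs: "(\<forall>j k. j \<noteq> k \<longrightarrow> P (?e j + ?e k)) \<longleftrightarrow>
      P (?e 1 + ?e 2) \<and> P (?e 1 + ?e 3) \<and> P (?e 2 + ?e 3)" for P
    unfolding forall_distinct_3 comm by blast
  show ?thesis
    \<comment> \<open>Each cardinality becomes a sum over \<open>U\<close>; after merging, the
      identity is checked separately for each \<open>v\<close>.\<close>
    unfolding alternating_sum apery_set_def exceptional_3_1_def exceptional_2_0_def
      exceptional_3_0_def exceptional_3_3_def card_level ex_3_1 ex_2_0
      all_pairs[where P = "\<lambda>w. v - w \<in> S" for v] all_pairs[where P = "\<lambda>w. v - w \<notin> S" for v]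
    unfolding forall_3 sum_distrib_left sum.distrib[symmetric] sum_subtractf[symmetric] N_def
    by (intro sum.cong refl inclusion_exclusion_3 conjI) (blast intro: down down' down3 down3')+
qed

end
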